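(* Let $z_0,z_1\in\ell'$, $k\in\mathbb{Z}\setminus\{0\}$, and let $u$ be a minimiser of $\mathcal M$ in $\mathcal H^k_{z_0z_1}$. Then $u$ is collision-free, i.e. $u(s)\neq0$ for all $s\in[0,1]$.
   Context: Fix $L,h,\beta>0$, $V_\beta(z)=-\frac1{|z|}-\frac{\beta}{|z|^2}$, $\ell=\{y=-L\}$, $\mathcal P=\{y>-L\}$. Winding number: for $u:[a,b]\to\overline{\mathcal P}$ with $u(a),u(b)\in\ell$, $u(s)\in\mathcal P\setminus\{0\}$ on $(a,b)$, $\operatorname{Ind}(u)$ is the winding number around $0$ of the closed curve formed by $u$ followed by the oriented segment from $u(b)$ to $u(a)$. Fix a solution $\hat{\mathcal Z}$ of $\ddot z=-\nabla V_\beta(z)$ at energy $h$ meeting $\ell$ at times $t_0<t_1$, in $\mathcal P$ on $(t_0,t_1)$, with winding number $1$ on $[t_0,t_1]$, the angle between $\dot{\hat{\mathcal Z}}(t_0)$ and $(1,0)$ less than $\pi/2$ and that between $(-1,0)$ and $\dot{\hat{\mathcal Z}}(t_1)$ greater than $\pi/2$. $\ell'$ is the segment of $\ell$ between $\hat{\mathcal Z}(t_0)$ and $\hat{\mathcal Z}(t_1)$; $D$ the compact region bounded by $\hat{\mathcal Z}([t_0,t_1])$ and $\ell'$. $\hat{\mathcal H}^k_{z_0z_1}=\{u\in H^1([0,1],D):u(0)=z_0,u(1)=z_1,u(s)\neq0\ \forall s,\operatorname{Ind}(u)=k\}$; $Coll_{z_0z_1}$ is the set of $u\in H^1([0,1],D)$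 with these endpoints and $u(s)=0$ for some $s$; $\mathcal H^k_{z_0z_1}=\hat{\mathcal H}^k_{z_0z_1}\sqcup Coll_{z_0z_1}$. $\mathcal M(u)=\frac12\int_0^1|\dot u|^2ds\int_0^1(h-V_\beta(u))ds$. *)

theory Defs
  imports "HOL-Complex_Analysis.Complex_Analysis"
begin

text \<open>The plane is identified with the complex numbers: (x,y) corresponds to x + i y.\<close>

definition Vb :: "real \<Rightarrow> complex \<Rightarrow> real" where
  "Vb \<beta> z = - 1 / cmod z - \<beta> / (cmod z)\<^sup>2"

definition minus_grad_Vb :: "real \<Rightarrow> complex \<Rightarrow> complex" where
  "minus_grad_Vb \<beta> z = - (z / of_real ((cmod z) ^ 3)) - (of_real (2 * \<beta>) * z / of_real ((cmod z) ^ 4))"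

definition vec_angle :: "complex \<Rightarrow> complex \<Rightarrow> real" where
  "vec_angle v w = arccos ((v \<bullet> w) / (norm v * norm w))"

definition Ind :: "(real \<Rightarrow> complex) \<Rightarrow> complex" where
  "Ind u = winding_number (u +++ linepath (u 1) (u 0)) 0"

definition H1 :: "(real \<Rightarrow> complex) \<Rightarrow> bool" where
  "H1 u \<longleftrightarrow> (\<exists>g. g absolutely_integrable_on {0..1} \<and>
                   (\<lambda>s. (norm (g s))\<^sup>2) integrable_on {0..1} \<and>
                   (\<forall>t\<in>{0..1}. (g has_integral (u t - u 0)) {0..t}))"

definition H1_into :: "complex set \<Rightarrow> complex \<Rightarrow> complex \<Rightarrow> (real \<Rightarrow> complex) set" where
  "H1_into D z0 z1 = {u. H1 u \<and> u ` {0..1} \<subseteq> D \<and> u 0 = z0 \<and> u 1 = z1}"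

definition Hhat :: "complex set \<Rightarrow> int \<Rightarrow> complex \<Rightarrow> complex \<Rightarrow> (real \<Rightarrow> complex) set" where
  "Hhat D k z0 z1 = {u \<in> H1_into D z0 z1. (\<forall>s\<in>{0..1}. u s \<noteq> 0) \<and> Ind u = of_int k}"

definition Coll :: "complex set \<Rightarrow> complex \<Rightarrow> complex \<Rightarrow> (real \<Rightarrow> complex) set" where
  "Coll D z0 z1 = {u \<in> H1_into D z0 z1. \<exists>s\<in>{0..1}. u s = 0}"

definition Hk :: "complex set \<Rightarrow> int \<Rightarrow> complex \<Rightarrow> complex \<Rightarrow> (real \<Rightarrow> complex) set" where
  "Hk D k z0 z1 = Hhat D k z0 z1 \<union> Coll D z0 z1"

definition pot :: "real \<Rightarrow> real \<Rightarrow> complex \<Rightarrow> ennreal" where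
  "pot \<beta> h z = (if z = 0 then \<infinity> else ennreal (h - Vb \<beta> z))"

text \<open>Maupertuis functional, with values in [0, +infinity]; the integrals are Lebesgue
  integrals over [0,1], the derivative being the a.e. derivative of the H^1 path.\<close>
definition Maup :: "real \<Rightarrow> real \<Rightarrow> (real \<Rightarrow> complex) \<Rightarrow> ennreal" where
  "Maup \<beta> h u =
     ennreal (1/2) *
     (\<integral>\<^sup>+ s\<in>{0..1}. ennreal ((norm (vector_derivative u (at s within {0..1})))\<^sup>2) \<partial>lebesgue) *
     (\<integral>\<^sup>+ s\<in>{0..1}. pot \<beta> h (u s) \<partial>lebesgue)"

end

theory Submission
  imports Defs
begin

text \<open>A collision path has infinite Maupertuis functional because the term \<open>\<beta> / |z|\<^sup>2\<close> is a strong
  force: by AM-GM, \<open>|g|\<^sup>2 + 1/|u|\<^sup>2 \<ge> 2 |g| / |u|\<close> for the weak derivative \<open>g\<close>, so each approach of \<open>u\<close> to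
  the origin costs at least a fixed amount on arbitrarily short time intervals, and \<open>1/|u|\<^sup>2\<close> cannot
  be integrable. On the other hand the boundary of \<open>D\<close> is a piecewise smooth loop of index 1
  avoiding the origin; running \<open>k\<close> times along it gives a collision-free competitor of index \<open>k\<close>
  with finite functional.\<close>

section \<open>Weak derivatives and Lebesgue differentiation\<close>

lemma has_integral_increment:
  fixes g :: "real \<Rightarrow> 'a::banach"
  assumes int: "\<And>t. t \<in> {a..b} \<Longrightarrow> (g has_integral (u t - u a)) {a..t}"
    and xy: "a \<le> x" "x \<le> y" "y \<le> b"
  shows "(g has_integral (u y - u x)) {x..y}"
proof -
  have gint: "g integrable_on {a..y}"
    using int[of y] xy by auto
  have "integral {a..x} g + integral {x..y} g = integral {a..y} g"
    by (rule Henstock_Kurzweil_Integration.integral_combine) (use xy gint in auto)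
  moreover have "integral {a..x} g = u x - u a" "integral {a..y} g = u y - u a"
    using xy int by (auto intro!: integral_unique)
  ultimately have "integral {x..y} g = u y - u x"
    by (simp add: algebra_simps)
  moreover have "g integrable_on {x..y}"
    using integrable_subinterval_real[OF gint] xy by auto
  ultimately show ?thesis
    by (metis integrable_integral)
qed

text \<open>Lebesgue differentiation: averages of \<open>g\<close> over shrinking intervals at
  \<open>x\<close> converge to \<open>g x\<close> for almost every \<open>x\<close>. This links the
  weak derivative in \<open>H1\<close> with the pointwise \<open>vector_derivative\<close> in
  \<open>Maup\<close>. \<open>integrable_ccontinuous_explicit\<close> treats intervals to the right
  of \<open>x\<close>; the left side comes from the reflected function.\<close>

lemma indefinite_integral_has_vector_derivative_ae:
  fixes g :: "real \<Rightarrow> 'a::euclidean_space"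
  assumes int: "\<And>t. t \<in> {a..b} \<Longrightarrow> (g has_integral (u t - u a)) {a..t}"
  obtains N where "negligible N"
    "\<And>x. x \<in> {a<..<b} - N \<Longrightarrow> (u has_vector_derivative g x) (at x)"
proof (cases "a < b")
  case False
  then show ?thesis using that[of "{}"] by auto
next
  case True
  \<comment> \<open>The zero extension is integrable on every box, as the averaging result
    demands.\<close>
  define f where "f x = (if x \<in> {a..b} then g x else 0)" for x
  have gint: "g integrable_on {a..b}"
    using int[of b] True by auto
  then have "f integrable_on UNIV"
    unfolding f_def by (simp only: integrable_restrict_UNIV)
  then have f_int: "f integrable_on cbox c d" for c d
    by (rule integrable_on_subcbox) auto
  then have f_int': "(\<lambda>x. f (- x)) integrable_on cbox c d" for c d
    using f_int[of "-d" "-c"] Henstock_Kurzweil_Integration.integrable_reflect_real[where f=f and a="-d" and b="-c"]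
    by simp
  have incr: "integral {x..y} f = u y - u x" if "a \<le> x" "x \<le> y" "y \<le> b" for x y
  proof -
    have "integral {x..y} f = integral {x..y} g"
      using that by (intro integral_cong) (auto simp: f_def)
    then show ?thesis
      using integral_unique[OF has_integral_increment[OF int that]] by simp
  qed
  obtain N1 where N1: "negligible N1" "\<And>x e. \<lbrakk>x \<notin> N1; 0 < e\<rbrakk> \<Longrightarrow>
      \<exists>d>0. \<forall>h. 0 < h \<and> h < d \<longrightarrow>
        norm (integral (cbox x (x + h *\<^sub>R One)) f /\<^sub>R h ^ DIM(real) - f x) < e"
    using integrable_ccontinuous_explicit[OF f_int] by blast
  obtain N2 where N2: "negligible N2" "\<And>x e. \<lbrakk>x \<notin> N2; 0 < e\<rbrakk> \<Longrightarrow>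
      \<exists>d>0. \<forall>h. 0 < h \<and> h < d \<longrightarrow>
        norm (integral (cbox x (x + h *\<^sub>R One)) (\<lambda>x. f (- x)) /\<^sub>R h ^ DIM(real) - f (- x)) < e"
    using integrable_ccontinuous_explicit[OF f_int'] by blast
  show ?thesis
  proof
    \<comment> \<open>\<open>N2\<close> is exceptional for the reflected function, so it is
      reflected back.\<close>
    show "negligible (N1 \<union> uminus ` N2)"
      using N1(1) negligible_differentiable_image_negligible[OF _ N2(1), of uminus]
      by (auto intro!: negligible_Un derivative_intros simp: differentiable_on_def)
    fix x assume x: "x \<in> {a<..<b} - (N1 \<union> uminus ` N2)"
    have xN: "x \<notin> N1" "- x \<notin> N2" and ab: "a < x" "x < b"
      using x imageI[of "- x" N2 uminus] by auto
    have fx: "f x = g x" using ab by (auto simp: f_def)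
    have *: "norm (v - h *\<^sub>R g x) \<le> e * h"
      if "norm (v /\<^sub>R h - g x) < e" "h > 0" for v h e
    proof -
      have "v - h *\<^sub>R g x = h *\<^sub>R (v /\<^sub>R h - g x)"
        using that by (simp add: algebra_simps)
      then have "norm (v - h *\<^sub>R g x) = h * norm (v /\<^sub>R h - g x)"
        using that by (metis abs_of_pos norm_scaleR)
      then show ?thesis using that by (simp add: mult.commute)
    qed
    show "(u has_vector_derivative g x) (at x)"
      unfolding has_vector_derivative_def has_derivative_at_alt
    proof (intro conjI allI impI bounded_linear_scaleR_left)
      fix e :: real assume e: "e > 0"
      obtain d1 where d1: "d1 > 0" "\<And>h. 0 < h \<Longrightarrow> h < d1 \<Longrightarrow>
          norm (integral {x..x + h} f /\<^sub>R h - g x) < e"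
        using N1(2)[OF xN(1) e] fx by auto
      obtain d2 where d2: "d2 > 0" "\<And>h. 0 < h \<Longrightarrow> h < d2 \<Longrightarrow>
          norm (integral {-x..-x + h} (\<lambda>x. f (- x)) /\<^sub>R h - g x) < e"
        using N2(2)[OF xN(2) e] fx by auto
      \<comment> \<open>Besides respecting both convergence radii, \<open>d\<close> keeps
        \<open>y\<close> inside the interval, where integrals of \<open>f\<close> are increments of
        \<open>u\<close>.\<close>
      define d where "d = Min {d1, d2, x - a, b - x}"
      have d: "d > 0" "d \<le> d1" "d \<le> d2" "d \<le> x - a" "d \<le> b - x"
        using d1(1) d2(1) ab by (auto simp: d_def)
      show "\<exists>d>0. \<forall>y. norm (y - x) < d \<longrightarrow>
          norm (u y - u x - (y - x) *\<^sub>R g x) \<le> e * norm (y - x)"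
      proof (intro exI[of _ d] conjI allI impI d(1))
        fix y assume y: "norm (y - x) < d"
        consider "y = x" | "y > x" | "y < x" by linarith
        then show "norm (u y - u x - (y - x) *\<^sub>R g x) \<le> e * norm (y - x)"
        proof cases
          case 1 then show ?thesis by simp
        next
          case 2
          have "norm (integral {x..x + (y - x)} f /\<^sub>R (y - x) - g x) < e"
            using d1(2)[of "y - x"] 2 y d by auto
          moreover have "integral {x..x + (y - x)} f = u y - u x"
            using incr[of x y] 2 y d ab by auto
          ultimately show ?thesis using *[where v="u y - u x" and h="y - x" and e=e] 2 by simp
        next
          case 3
          have "norm (integral {-x..-x + (x - y)} (\<lambda>x. f (- x)) /\<^sub>R (x - y) - g x) < e"
            using d2(2)[of "x - y"] 3 y d by auto
          moreover have "integral {-x..-x + (x - y)} (\<lambda>x. f (- x)) = u x - u y"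
            using incr[of y x] 3 y d ab Henstock_Kurzweil_Integration.integral_reflect_real[where f=f and a=y and b=x] by auto
          ultimately have "norm (u x - u y - (x - y) *\<^sub>R g x) \<le> e * (x - y)"
            using *[where v="u x - u y" and h="x - y" and e=e] 3 by simp
          moreover have "u y - u x - (y - x) *\<^sub>R g x = - (u x - u y - (x - y) *\<^sub>R g x)"
            by (simp add: algebra_simps)
          ultimately show ?thesis using 3 by (metis abs_minus_commute abs_of_pos diff_gt_0_iff_gt norm_minus_cancel real_norm_def)
        qed
      qed
    qed
  qed
qed

section \<open>Collisions force an infinite functional\<close>

lemma H1_continuous:
  assumes "H1 u"
  shows "continuous_on {0..1} u"
proof -
  obtain g where g_int: "\<And>t. t \<in> {0..1} \<Longrightarrow> (g has_integral (u t - u 0)) {0..t}"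
    using assms unfolding H1_def by blast
  have gi: "g integrable_on {0..1}"
    using g_int[of 1] by auto
  have eq: "u 0 + integral {0..t} g = u t" if "t \<in> {0..1}" for t
    using integral_unique[OF g_int[OF that]] by simp
  have "continuous_on {0..1} (\<lambda>t. u 0 + integral {0..t} g)"
    by (intro continuous_on_add continuous_on_const indefinite_integral_continuous_1 gi)
  then show ?thesis
    using eq by (rule continuous_on_eq)
qed

text \<open>Since \<open>0 * \<infinity> = 0\<close> in \<open>ennreal\<close>, an infinite
  potential factor makes \<open>Maup\<close> infinite only when the kinetic factor is nonzero. Were
  the latter zero, \<open>g\<close> would vanish almost everywhere, and so would its integral
  \<open>u s - u 0\<close>.\<close>

lemma kinetic_pos:
  assumes "H1 u" "s \<in> {0..1}" "u s \<noteq> u 0"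
  shows "(\<integral>\<^sup>+ s\<in>{0..1}. ennreal ((norm (vector_derivative u (at s within {0..1})))\<^sup>2) \<partial>lebesgue) > 0"
proof (rule ccontr)
  assume "\<not> ?thesis"
  then have zero: "(\<integral>\<^sup>+ s\<in>{0..1}. ennreal ((norm (vector_derivative u (at s within {0..1})))\<^sup>2) \<partial>lebesgue) = 0"
    by simp
  obtain g where g: "g absolutely_integrable_on {0..1}"
    and g_int: "\<And>t. t \<in> {0..1} \<Longrightarrow> (g has_integral (u t - u 0)) {0..t}"
    using assms(1) unfolding H1_def by blast
  obtain N where N: "negligible N"
    "\<And>x. x \<in> {0<..<1} - N \<Longrightarrow> (u has_vector_derivative g x) (at x)"
    using indefinite_integral_has_vector_derivative_ae[OF g_int] by blast
  have ae: "AE x in lebesgue. x \<notin> N \<union> {0, 1}"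
    using negligible_Un[OF N(1) negligible_finite[of "{0, 1}"]]
    by (intro AE_not_in) (simp only: negligible_iff_null_sets finite.intros)
  have vd: "vector_derivative u (at x within {0..1}) = g x" if "x \<in> {0..1}" "x \<notin> N \<union> {0, 1}" for x
    using that N(2)[of x] vector_derivative_at_within_ivl[of u "g x" x 0 1] by auto
  \<comment> \<open>The pointwise derivative is traded for \<open>g\<close>, whose measurability is
    at hand and allows passing from a zero integral to zero almost everywhere.\<close>
  have meas: "(\<lambda>x. indicator {0..1} x *\<^sub>R g x) \<in> borel_measurable lebesgue"
    using g by (auto simp: set_integrable_def)
  have "AE s in lebesgue. ennreal ((norm (indicator {0..1} s *\<^sub>R g s))\<^sup>2) =
      ennreal ((norm (vector_derivative u (at s within {0..1})))\<^sup>2) * indicator {0..1} s"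
    using ae
  proof eventually_elim
    case (elim s)
    then show ?case
      using vd[of s] by (cases "s \<in> {0..1}") simp_all
  qed
  then have "(\<integral>\<^sup>+ s. ennreal ((norm (indicator {0..1} s *\<^sub>R g s))\<^sup>2) \<partial>lebesgue) = 0"
    using zero by (simp only: nn_integral_cong_AE)
  moreover have "(\<lambda>s. ennreal ((norm (indicator {0..1} s *\<^sub>R g s))\<^sup>2)) \<in> borel_measurable lebesgue"
    using meas by measurable
  ultimately have "AE s in lebesgue. ennreal ((norm (indicator {0..1} s *\<^sub>R g s))\<^sup>2) = 0"
    by (subst (asm) nn_integral_0_iff_AE) auto
  then have "AE x in lebesgue. x \<in> {0..1} \<longrightarrow> g x = 0"
    by eventually_elim (auto split: split_indicator_asm)
  then obtain M where M: "M \<in> null_sets lebesgue" "{x. \<not> (x \<in> {0..1} \<longrightarrow> g x = 0)} \<subseteq> M"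
    unfolding eventually_ae_filter by auto
  have "((\<lambda>x. 0) has_integral (u s - u 0)) {0..s}"
  proof (rule has_integral_spike[OF _ _ g_int])
    show "negligible M" using M by (simp add: negligible_iff_null_sets)
  qed (use M assms(2) in auto)
  then have "u s - u 0 = 0"
    using has_integral_0 by (rule has_integral_unique)
  then show False using assms by simp
qed

text \<open>Let \<open>m\<close> be the largest modulus of \<open>u\<close> on a short window ending
  at the first collision. From the point where it is attained, \<open>u\<close> must cover a
  distance at least \<open>m\<close> while \<open>1 / norm (u s)\<close> stays at least
  \<open>1 / m\<close>. By AM-GM the integral of \<open>f\<close> there is at least 2, whereas
  integrability makes it less than 1 on short windows.\<close>

lemma inverse_square_integral_infinite:
  fixes u :: "real \<Rightarrow> complex"
  assumes "H1 u" "s0 \<in> {0..1}" "u s0 = 0" "u 0 \<noteq> 0"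
  shows "\<not> (\<lambda>s. 1 / (norm (u s))\<^sup>2) integrable_on {0..1}"
proof
  assume I: "(\<lambda>s. 1 / (norm (u s))\<^sup>2) integrable_on {0..1}"
  obtain g where g: "g absolutely_integrable_on {0..1}"
    and g2: "(\<lambda>s. (norm (g s))\<^sup>2) integrable_on {0..1}"
    and g_int: "\<And>t. t \<in> {0..1} \<Longrightarrow> (g has_integral (u t - u 0)) {0..t}"
    using assms(1) unfolding H1_def by blast
  have cont: "continuous_on {0..1} u" by (rule H1_continuous[OF assms(1)])
  have "compact {s \<in> {0..1}. u s \<in> {0}}"
    unfolding compact_eq_bounded_closed
    using continuous_closed_preimage[OF cont closed_atLeastAtMost, of "{0}"]
    by (auto simp: vimage_def Int_def intro: bounded_subset[OF bounded_closed_interval])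
  \<comment> \<open>At the first collision time the path has no zeros just before it, so the AM-GM
    bound is not spoiled by \<open>1 / 0 = 0\<close>.\<close>
  then obtain s1 where s1: "s1 \<in> {0..1}" "u s1 = 0"
    and first: "\<And>s. s \<in> {0..1} \<Longrightarrow> u s = 0 \<Longrightarrow> s1 \<le> s"
    using compact_attains_inf[of "{s \<in> {0..1}. u s \<in> {0}}"] assms by auto
  have s1_pos: "s1 > 0"
    using s1 assms(4) by (metis atLeastAtMost_iff order_le_less)
  define f where "f s = (norm (g s))\<^sup>2 + 1 / (norm (u s))\<^sup>2" for s
  have fi: "f integrable_on {0..1}"
    unfolding f_def by (intro integrable_add g2 I)
  \<comment> \<open>Continuity of the indefinite integral gives the window length \<open>d\<close>
    on which \<open>f\<close> contributes less than 1.\<close>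
  have "continuous_on {0..1} (\<lambda>t. integral {0..t} f)"
    by (rule indefinite_integral_continuous_1[OF fi])
  then obtain d where d: "d > 0" "\<And>t. t \<in> {0..1} \<Longrightarrow> dist t s1 < d \<Longrightarrow>
      dist (integral {0..t} f) (integral {0..s1} f) < 1"
    using s1(1) unfolding continuous_on_iff by (metis zero_less_one)
  define c where "c = max 0 (s1 - d / 2)"
  have c: "0 \<le> c" "c < s1" "s1 - c < d"
    using d(1) s1_pos by (auto simp: c_def)
  have "continuous_on {c..s1} (\<lambda>s. norm (u s))"
    by (intro continuous_on_norm continuous_on_subset[OF cont]) (use c s1 in auto)
  then obtain a where a: "a \<in> {c..s1}" and max: "\<And>s. s \<in> {c..s1} \<Longrightarrow> norm (u s) \<le> norm (u a)"
    using continuous_attains_sup[of "{c..s1}" "\<lambda>s. norm (u s)"] c by auto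
  define m where "m = norm (u a)"
  have "u c \<noteq> 0" using first[of c] c s1 by auto
  then have m: "m > 0" using max[of c] c by (auto simp: m_def intro: less_le_trans)
  then have a_less: "a < s1" using a s1(2) by (auto simp: m_def order_le_less)
  have sub: "{a..s1} \<subseteq> {0..1}" using a c s1 by auto
  \<comment> \<open>At \<open>s1\<close> the term \<open>1 / (norm (u s))\<^sup>2\<close> in
    \<open>f\<close> is \<open>1 / 0 = 0\<close>, so the pointwise bound could fail there; resetting
    one value leaves the integral unchanged.\<close>
  define G where "G s = (if s = s1 then 0 else (2 / m) * norm (g s))" for s
  have inc: "(g has_integral (u s1 - u a)) {a..s1}"
    by (rule has_integral_increment[OF g_int]) (use a c s1 in auto)
  have gn: "(\<lambda>s. norm (g s)) integrable_on {a..s1}"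
    using g sub integrable_on_subinterval unfolding absolutely_integrable_on_def by blast
  have "m \<le> integral {a..s1} (\<lambda>s. norm (g s))"
  proof -
    have "norm (integral {a..s1} g) \<le> integral {a..s1} (\<lambda>s. norm (g s))"
      by (rule integral_norm_bound_integral) (use inc gn in auto)
    then show ?thesis using integral_unique[OF inc] s1(2) by (simp add: m_def)
  qed
  then have "2 \<le> integral {a..s1} (\<lambda>s. (2 / m) * norm (g s))"
    using m by (simp add: field_simps)
  also have "\<dots> = integral {a..s1} G"
    by (rule integral_spike[of "{s1}"]) (auto simp: G_def)
  also have "\<dots> \<le> integral {a..s1} f"
  proof (rule integral_le)
    show "G integrable_on {a..s1}"
      by (rule integrable_spike[of "\<lambda>s. (2 / m) * norm (g s)" _ "{s1}"])
        (use integrable_on_cmult_left[OF gn, of "2 / m"] in \<open>auto simp: G_def\<close>)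
    show "f integrable_on {a..s1}"
      using fi sub by (meson integrable_on_subinterval)
    fix s assume s: "s \<in> {a..s1}"
    show "G s \<le> f s"
    proof (cases "s = s1")
      case True then show ?thesis by (simp add: G_def f_def)
    next
      case False
      then have "u s \<noteq> 0" using first[of s] s sub by force
      then have us: "0 < norm (u s)" "norm (u s) \<le> m" using max[of s] s a by (auto simp: m_def)
      have "(2 / m) * norm (g s) \<le> 2 * (1 / norm (u s)) * norm (g s)"
        using us m by (intro mult_right_mono) (simp_all add: frac_le)
      also have "\<dots> \<le> (norm (g s))\<^sup>2 + (1 / norm (u s))\<^sup>2"
        using sum_squares_bound[of "norm (g s)" "1 / norm (u s)"] by (simp add: mult_ac)
      finally show ?thesis using False by (simp add: G_def f_def power_divide)
    qed
  qed
  also have "\<dots> = integral {0..s1} f - integral {0..a} f"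
    using Henstock_Kurzweil_Integration.integral_combine[of 0 a s1 f]
      integrable_subinterval_real[OF fi, of 0 s1] a c s1 by auto
  also have "\<dots> < 1"
    using d(2)[of a] a c s1 by (auto simp: dist_real_def)
  finally show False by simp
qed

lemma Maup_collision:
  assumes "\<beta> > 0" "h > 0" "u \<in> Coll D z0 z1" "z0 \<noteq> 0"
  shows "Maup \<beta> h u = \<infinity>"
proof -
  obtain s0 where s0: "s0 \<in> {0..1}" "u s0 = 0" and H: "H1 u" "u 0 \<noteq> 0"
    using assms by (auto simp: Coll_def H1_into_def)
  have cont: "continuous_on {0..1} u" by (rule H1_continuous[OF H(1)])
  define f where "f s = indicator {0..1} s * (1 / (norm (u s))\<^sup>2)" for s
  have meas: "f \<in> borel_measurable lebesgue"
  proof -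
    \<comment> \<open>Nothing is known of \<open>u\<close> outside the unit interval, so
      measurability is shown for its cut-off, which yields the same \<open>f\<close>.\<close>
    have "(\<lambda>s. indicator {0..1} s *\<^sub>R u s) \<in> borel_measurable borel"
      using borel_measurable_continuous_on_indicator[OF _ cont] by simp
    then have "(\<lambda>s. 1 / (norm (indicator {0..1} s *\<^sub>R u s))\<^sup>2) \<in> borel_measurable borel"
      by measurable
    then have "(\<lambda>s. indicator {0..1} s * (1 / (norm (indicator {0..1} s *\<^sub>R u s))\<^sup>2)) \<in> borel_measurable borel"
      by (intro borel_measurable_times borel_measurable_indicator) auto
    moreover have "f = (\<lambda>s. indicator {0..1} s * (1 / (norm (indicator {0..1} s *\<^sub>R u s))\<^sup>2))"
      by (auto simp: f_def fun_eq_iff split: split_indicator)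
    ultimately have "f \<in> borel_measurable borel" by (simp only:)
    then show ?thesis by (simp add: measurable_completion)
  qed
  have "(\<integral>\<^sup>+ s. f s \<partial>lebesgue) = \<infinity>"
  proof (rule ccontr)
    assume fin: "(\<integral>\<^sup>+ s. f s \<partial>lebesgue) \<noteq> \<infinity>"
    define r where "r = enn2real (\<integral>\<^sup>+ s. f s \<partial>lebesgue)"
    \<comment> \<open>A finite Lebesgue integral of the nonnegative \<open>f\<close> is also a gauge
      integral, which the previous lemma excludes.\<close>
    have "(f has_integral r) UNIV"
      by (subst has_integral_iff_nn_integral_lebesgue)
        (use meas fin in \<open>auto simp: f_def r_def top.not_eq_extremum\<close>)
    then have "f integrable_on UNIV" by auto
    moreover have "f = (\<lambda>s. if s \<in> {0..1} then 1 / (norm (u s))\<^sup>2 else 0)"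
      by (auto simp: f_def)
    ultimately have "(\<lambda>s. 1 / (norm (u s))\<^sup>2) integrable_on {0..1}"
      by (simp only: integrable_restrict_UNIV)
    then show False
      using inverse_square_integral_infinite[OF H(1) s0 H(2)] by blast
  qed
  then have "\<infinity> = ennreal \<beta> * (\<integral>\<^sup>+ s. f s \<partial>lebesgue)"
    using assms(1) by (simp add: ennreal_mult_top)
  also have "\<dots> = (\<integral>\<^sup>+ s. ennreal \<beta> * f s \<partial>lebesgue)"
    using meas by (intro nn_integral_cmult[symmetric]) auto
  also have "\<dots> \<le> (\<integral>\<^sup>+ s\<in>{0..1}. pot \<beta> h (u s) \<partial>lebesgue)"
  proof (rule nn_integral_mono)
    \<comment> \<open>At a zero of \<open>u\<close>, \<open>f s\<close> is 0 by the division
      convention while \<open>pot\<close> is infinite; elsewhere the remaining terms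
      \<open>h + 1 / norm (u s)\<close> are positive.\<close>
    fix s :: real
    show "ennreal \<beta> * f s \<le> pot \<beta> h (u s) * indicator {0..1} s"
      using assms by (auto simp: f_def pot_def Vb_def simp flip: ennreal_mult' intro!: ennreal_leI split: split_indicator)
  qed
  finally have pot: "(\<integral>\<^sup>+ s\<in>{0..1}. pot \<beta> h (u s) \<partial>lebesgue) = \<infinity>"
    by (simp add: top_unique)
  show ?thesis
    unfolding Maup_def pot using kinetic_pos[OF H(1) s0(1)] s0(2) H(2)
    by (simp add: ennreal_mult_top zero_less_iff_neq_zero)
qed

section \<open>Lipschitz paths avoiding the origin have finite functional\<close>

lemma lipschitz_vector_derivative_bound:
  fixes f :: "real \<Rightarrow> 'a::real_normed_vector"
  assumes lip: "B-lipschitz_on {a..b} f" and x: "x \<in> {a..b}" and ab: "a < b"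
    and der: "(f has_vector_derivative d) (at x within {a..b})"
  shows "norm d \<le> B"
proof -
  have nonbot: "at x within {a..b} \<noteq> bot"
    using x ab by (simp add: trivial_limit_within)
  have "norm d \<le> B + e" if "e > 0" for e
  proof -
    have "\<forall>\<^sub>F y in at x within {a..b}. norm (f y - f x - (y - x) *\<^sub>R d) \<le> e * norm (y - x)"
      using der that unfolding has_vector_derivative_def has_derivative_within_alt2 by blast
    moreover have "\<forall>\<^sub>F y in at x within {a..b}. y \<in> {a..b} \<and> y \<noteq> x"
      by (auto simp: eventually_at intro: exI[of _ 1])
    ultimately obtain y where y: "norm (f y - f x - (y - x) *\<^sub>R d) \<le> e * norm (y - x)"
      "y \<in> {a..b}" "y \<noteq> x"
      using eventually_happens'[OF nonbot eventually_conj] by blast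
    have "norm (y - x) * norm d = norm ((f y - f x) - (f y - f x - (y - x) *\<^sub>R d))"
      by simp
    also have "\<dots> \<le> norm (f y - f x) + norm (f y - f x - (y - x) *\<^sub>R d)"
      by (rule norm_triangle_ineq4)
    also have "\<dots> \<le> B * norm (y - x) + e * norm (y - x)"
      using lipschitz_onD[OF lip y(2) x] y(1) by (simp add: dist_norm)
    finally have "norm (y - x) * norm d \<le> norm (y - x) * (B + e)"
      by (simp add: algebra_simps)
    then show ?thesis using y(3) by simp
  qed
  then show ?thesis by (rule field_le_epsilon)
qed

text \<open>The fundamental theorem of calculus tolerates the finitely many break points and makes
  the classical derivative a weak one. A valid path may still have unbounded derivative near a break
  point; the Lipschitz constant rules this out and gives square integrability.\<close>

lemma valid_lipschitz_H1:
  assumes v: "valid_path v" and lip: "B-lipschitz_on {0..1} v"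
  shows "H1 v"
proof -
  obtain S D where cont: "continuous_on {0..1} v" and S: "finite S"
    and D: "\<And>x. x \<in> {0..1} - S \<Longrightarrow> (v has_vector_derivative D x) (at x)"
    using v unfolding valid_path_def piecewise_C1_differentiable_on_def C1_differentiable_on_def
    by metis
  \<comment> \<open>The value 0 at break points and endpoints makes the bound by \<open>B\<close>
    hold everywhere.\<close>
  define g where "g x = (if x \<in> S \<union> {0, 1} then 0 else D x)" for x
  have der: "(v has_vector_derivative g x) (at x)" if "x \<in> {0<..<1} - S" for x
    using D[of x] that by (simp add: g_def)
  have int: "(g has_integral (v t - v 0)) {0..t}" if "t \<in> {0..1}" for t
    by (rule fundamental_theorem_of_calculus_interior_strong[OF S])
      (use that der in \<open>auto intro: continuous_on_subset[OF cont]\<close>)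
  have B: "B \<ge> 0" using lip by (rule lipschitz_on_nonneg)
  have bound: "norm (g x) \<le> B" if "x \<in> {0..1}" for x
  proof (cases "x \<in> S \<union> {0, 1}")
    case True then show ?thesis using B by (simp add: g_def)
  next
    case False
    then have x: "x \<in> {0<..<1} - S" using that by auto
    show ?thesis
      by (rule lipschitz_vector_derivative_bound[OF lip _ _ has_vector_derivative_at_within[OF der[OF x]]]) (use x in auto)
  qed
  have gi: "g integrable_on {0..1}" using int[of 1] by auto
  have meas: "g \<in> borel_measurable (lebesgue_on {0..1})"
    by (rule integrable_imp_measurable[OF gi])
  have "(\<lambda>x. norm (g x)) integrable_on {0..1}"
    by (rule measurable_bounded_by_integrable_imp_integrable[of _ _ "\<lambda>_. B"])
      (use meas bound in auto)
  then have "g absolutely_integrable_on {0..1}"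
    using gi by (simp add: absolutely_integrable_on_def)
  moreover have "(\<lambda>x. (norm (g x))\<^sup>2) integrable_on {0..1}"
    by (rule measurable_bounded_by_integrable_imp_integrable[of _ _ "\<lambda>_. B\<^sup>2"])
      (use meas bound in \<open>auto intro: power_mono\<close>)
  ultimately show ?thesis
    using int unfolding H1_def by blast
qed

lemma Maup_lipschitz_finite:
  assumes "\<beta> > 0" "h > 0" and lip: "B-lipschitz_on {0..1} v" and nz: "\<And>s. s \<in> {0..1} \<Longrightarrow> v s \<noteq> 0"
  shows "Maup \<beta> h v < \<infinity>"
proof -
  \<comment> \<open>Where \<open>v\<close> is not differentiable, \<open>vector_derivative\<close>
    is the arbitrary value \<open>SOME d. False\<close>. Including its norm bounds the integrand at
    every point.\<close>
  define c where "c = norm (SOME d :: complex. False)"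
  have vd: "norm (vector_derivative v (at s within {0..1})) \<le> max B c" if s: "s \<in> {0..1}" for s
  proof (cases "\<exists>d. (v has_vector_derivative d) (at s within {0..1})")
    case True
    then have "(v has_vector_derivative vector_derivative v (at s within {0..1})) (at s within {0..1})"
      unfolding vector_derivative_def by (rule someI_ex)
    then show ?thesis
      using lipschitz_vector_derivative_bound[OF lip s] s by (simp add: max.coboundedI1)
  next
    case False
    then show ?thesis by (simp add: vector_derivative_def c_def)
  qed
  have cont: "continuous_on {0..1} (\<lambda>s. norm (v s))"
    by (intro continuous_on_norm lipschitz_on_continuous_on[OF lip])
  \<comment> \<open>The potential integrand is largest where \<open>v\<close> is closest to the
    origin, and that distance is positive by compactness.\<close>
  obtain a where a: "a \<in> {0..1}" and min: "\<And>s. s \<in> {0..1} \<Longrightarrow> norm (v a) \<le> norm (v s)"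
    using continuous_attains_inf[OF _ _ cont] by auto
  have va: "norm (v a) > 0" using nz[OF a] by simp
  have "(\<integral>\<^sup>+ s\<in>{0..1}. ennreal ((norm (vector_derivative v (at s within {0..1})))\<^sup>2) \<partial>lebesgue)
      \<le> (\<integral>\<^sup>+ s\<in>{0..1::real}. ennreal ((max B c)\<^sup>2) \<partial>lebesgue)"
    by (intro nn_integral_mono) (auto split: split_indicator intro!: ennreal_leI power_mono vd)
  also have "\<dots> < \<infinity>" by (simp add: nn_integral_cmult_indicator ennreal_mult_less_top)
  finally have K: "(\<integral>\<^sup>+ s\<in>{0..1}. ennreal ((norm (vector_derivative v (at s within {0..1})))\<^sup>2) \<partial>lebesgue) < \<infinity>" .
  have "pot \<beta> h (v s) \<le> ennreal (h - Vb \<beta> (v a))" if "s \<in> {0..1}" for s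
    unfolding pot_def Vb_def using nz[OF that] min[OF that] va assms(1)
    by (auto intro!: ennreal_leI add_mono divide_left_mono power_mono)
  then have "(\<integral>\<^sup>+ s\<in>{0..1}. pot \<beta> h (v s) \<partial>lebesgue) \<le> (\<integral>\<^sup>+ s\<in>{0..1::real}. ennreal (h - Vb \<beta> (v a)) \<partial>lebesgue)"
    by (intro nn_integral_mono) (auto split: split_indicator)
  also have "\<dots> < \<infinity>" by (simp add: nn_integral_cmult_indicator ennreal_mult_less_top)
  finally show ?thesis
    using K unfolding Maup_def by (simp add: ennreal_mult_less_top del: ennreal_half)
qed

section \<open>Lipschitz loops of prescribed index\<close>

text \<open>The factor 2 arises because \<open>+++\<close> runs each piece at double speed.\<close>

lemma lipschitz_joinpaths:
  fixes p q :: "real \<Rightarrow> 'a::real_normed_vector"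
  assumes p: "A-lipschitz_on {0..1} p" and q: "B-lipschitz_on {0..1} q"
    and pq: "pathfinish p = pathstart q"
  shows "(2 * max A B)-lipschitz_on {0..1} (p +++ q)"
proof -
  have "(A * 2)-lipschitz_on {0..1/2} (\<lambda>x. p (2 * x))"
  proof (rule lipschitz_onI)
    fix x y :: real assume "x \<in> {0..1/2}" "y \<in> {0..1/2}"
    then show "dist (p (2 * x)) (p (2 * y)) \<le> A * 2 * dist x y"
      using lipschitz_onD[OF p, of "2 * x" "2 * y"] by (simp add: dist_real_def abs_if algebra_simps split: if_splits)
  qed (use lipschitz_on_nonneg[OF p] in simp)
  moreover have "(B * 2)-lipschitz_on {1/2..1} (\<lambda>x. q (2 * x - 1))"
  proof (rule lipschitz_onI)
    fix x y :: real assume "x \<in> {1/2..1}" "y \<in> {1/2..1}"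
    then show "dist (q (2 * x - 1)) (q (2 * y - 1)) \<le> B * 2 * dist x y"
      using lipschitz_onD[OF q, of "2 * x - 1" "2 * y - 1"] by (simp add: dist_real_def abs_if algebra_simps split: if_splits)
  qed (use lipschitz_on_nonneg[OF q] in simp)
  ultimately have "(max (A * 2) (B * 2))-lipschitz_on {0..1} (p +++ q)"
    unfolding joinpaths_def using pq
    by (intro lipschitz_on_concat_max) (auto simp: pathfinish_def pathstart_def)
  then show ?thesis by (rule lipschitz_on_mono) auto
qed

lemma lipschitz_reversepath:
  assumes p: "A-lipschitz_on {0..1} p"
  shows "A-lipschitz_on {0..1} (reversepath p)"
proof (rule lipschitz_onI)
  fix x y :: real assume "x \<in> {0..1}" "y \<in> {0..1}"
  then show "dist (reversepath p x) (reversepath p y) \<le> A * dist x y"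
    using lipschitz_onD[OF p, of "1 - x" "1 - y"] by (simp add: reversepath_def dist_real_def abs_minus_commute)
qed (rule lipschitz_on_nonneg[OF p])

lemma lipschitz_linepath: "(norm (b - a))-lipschitz_on S (linepath a b)"
proof (rule lipschitz_onI)
  fix x y :: real
  have "linepath a b x - linepath a b y = (x - y) *\<^sub>R (b - a)"
    by (simp add: linepath_def algebra_simps)
  then show "dist (linepath a b x) (linepath a b y) \<le> norm (b - a) * dist x y"
    by (simp add: dist_norm)
qed simp

text \<open>Induction: start from the constant path and prepend one copy of \<open>c\<close> each
  time. Keeping the image inside that of \<open>c\<close> later ensures that the loop stays in
  \<open>D\<close> and misses the origin.\<close>

lemma exists_loop_winding_multiple:
  assumes c: "valid_path c" "A-lipschitz_on {0..1} c" "pathfinish c = pathstart c" "z \<notin> path_image c"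
  shows "\<exists>p B. valid_path p \<and> B-lipschitz_on {0..1} p \<and> path_image p \<subseteq> path_image c \<and>
    pathstart p = pathstart c \<and> pathfinish p = pathstart c \<and>
    winding_number p z = of_nat n * winding_number c z"
proof (induction n)
  case 0
  have "pathstart c \<in> path_image c" by (rule pathstart_in_path_image)
  then have "z \<noteq> pathstart c" using c(4) by blast
  then have "winding_number (linepath (pathstart c) (pathstart c)) z = 0"
    by (rule winding_number_trivial)
  moreover have "path_image (linepath (pathstart c) (pathstart c)) \<subseteq> path_image c"
    by auto
  ultimately show ?case
    using lipschitz_linepath by (metis mult_zero_left of_nat_0 pathfinish_linepath pathstart_linepath valid_path_linepath)
next
  case (Suc n)
  then obtain p B where p: "valid_path p" "B-lipschitz_on {0..1} p" "path_image p \<subseteq> path_image c"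
    "pathstart p = pathstart c" "pathfinish p = pathstart c"
    "winding_number p z = of_nat n * winding_number c z" by blast
  have "winding_number (c +++ p) z = winding_number c z + winding_number p z"
    using c p by (intro winding_number_join) (auto simp: valid_path_imp_path)
  moreover have "(2 * max A B)-lipschitz_on {0..1} (c +++ p)"
    using c p by (intro lipschitz_joinpaths) auto
  ultimately show ?case
    using c p
    by (intro exI[of _ "c +++ p"] exI[of _ "2 * max A B"]) (auto simp: path_image_join algebra_simps)
qed

lemma exists_loop_winding:
  assumes c: "valid_path c" "A-lipschitz_on {0..1} c" "pathfinish c = pathstart c" "z \<notin> path_image c"
    and w: "winding_number c z = 1"
  shows "\<exists>p B. valid_path p \<and> B-lipschitz_on {0..1} p \<and> path_image p \<subseteq> path_image c \<and>
    pathstart p = pathstart c \<and> pathfinish p = pathstart c \<and>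
    winding_number p z = of_int k"
proof -
  obtain p B where p: "valid_path p" "B-lipschitz_on {0..1} p" "path_image p \<subseteq> path_image c"
    "pathstart p = pathstart c" "pathfinish p = pathstart c"
    "winding_number p z = of_nat (nat \<bar>k\<bar>) * winding_number c z"
    using exists_loop_winding_multiple[OF c] by blast
  show ?thesis
  proof (cases "k \<ge> 0")
    case True
    then show ?thesis using p w by (intro exI[of _ p] exI[of _ B]) auto
  next
    case False
    \<comment> \<open>Negative indices come from traversing the loop backwards.\<close>
    have "winding_number (reversepath p) z = - winding_number p z"
      using p c by (intro winding_number_reversepath) (auto simp: valid_path_imp_path)
    then show ?thesis
      using p w False lipschitz_reversepath[OF p(2)] by (intro exI[of _ "reversepath p"] exI[of _ B]) auto
  qed
qed

lemma C1_imp_valid_lipschitz: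
  fixes p :: "real \<Rightarrow> complex"
  assumes der: "\<And>s. s \<in> {0..1} \<Longrightarrow> (p has_vector_derivative p' s) (at s)"
    and cont: "continuous_on {0..1} p'"
  obtains B where "valid_path p" "B-lipschitz_on {0..1} p"
proof -
  have "p C1_differentiable_on {0..1}"
    unfolding C1_differentiable_on_def using der cont by blast
  then have valid: "valid_path p"
    unfolding valid_path_def by (rule C1_differentiable_imp_piecewise)
  have "bounded (p' ` {0..1})"
    by (intro compact_imp_bounded compact_continuous_image cont) auto
  then obtain B where B: "B > 0" "\<And>s. s \<in> {0..1} \<Longrightarrow> norm (p' s) \<le> B"
    unfolding bounded_pos by auto
  have "B-lipschitz_on {0..1} p"
  proof (rule lipschitz_onI)
    fix x y :: real assume xy: "x \<in> {0..1}" "y \<in> {0..1}"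
    have "norm (p x - p y) \<le> B * norm (x - y)"
    proof (rule differentiable_bound[OF _ _ _ xy])
      fix s :: real assume s: "s \<in> {0..1}"
      show "(p has_derivative (\<lambda>h. h *\<^sub>R p' s)) (at s within {0..1})"
        using der[OF s] by (simp add: has_vector_derivative_def has_derivative_at_withinI)
      show "onorm (\<lambda>h. h *\<^sub>R p' s) \<le> B"
        using B(2)[OF s] B(1) by (intro onorm_bound) (auto simp: mult.commute[of B] mult_left_mono)
    qed simp
    then show "dist (p x) (p y) \<le> B * dist x y" by (simp add: dist_norm)
  qed (use B in simp)
  with valid show thesis by (rule that)
qed

section \<open>The collision-free competitor of index \<open>k\<close>\<close>

text \<open>The closed triangle stays in a convex set missing \<open>z\<close>, so it cannot wind
  around \<open>z\<close>. Each summand belongs to an open path and need not be an integer; only the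
  sum is controlled.\<close>

lemma winding_number_triangle_eq_0:
  assumes "convex S" "a \<in> S" "b \<in> S" "c \<in> S" "z \<notin> S"
  shows "winding_number (linepath a b) z + winding_number (linepath b c) z + winding_number (linepath c a) z = 0"
proof -
  have sub: "closed_segment x y \<subseteq> S" if "x \<in> S" "y \<in> S" for x y
    using that assms(1) by (rule closed_segment_subset)
  have seg: "z \<notin> closed_segment a b" "z \<notin> closed_segment b c" "z \<notin> closed_segment c a"
    using sub assms by blast+
  have "winding_number (linepath a b +++ linepath b c +++ linepath c a) z = 0"
    by (rule winding_number_zero_outside[OF _ assms(1) _ assms(5)])
      (use sub assms in \<open>auto simp: path_image_join\<close>)
  moreover have "winding_number (linepath a b +++ linepath b c +++ linepath c a) z =
      winding_number (linepath a b) z + (winding_number (linepath b c) z + winding_number (linepath c a) z)"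
    using seg by (simp add: winding_number_join path_image_join)
  ultimately show ?thesis by (simp add: add.assoc)
qed

text \<open>Together with the closing segment, the two straight connections to the base point of \<open>c\<close> form a
  degenerate triangle inside \<open>S\<close>, which contributes nothing to the index.\<close>

lemma exists_finite_Maup_competitor:
  assumes "\<beta> > 0" "h > 0"
    and c: "valid_path c" "A-lipschitz_on {0..1} c" "pathfinish c = pathstart c" "0 \<notin> path_image c"
    and w: "winding_number c 0 = 1"
    and S: "convex S" "0 \<notin> S" "S \<subseteq> D" "pathstart c \<in> S" "z0 \<in> S" "z1 \<in> S"
    and D: "path_image c \<subseteq> D"
  obtains v where "v \<in> Hhat D k z0 z1" "Maup \<beta> h v < \<infinity>"
proof -
  define a where "a = pathstart c"
  obtain p B where p: "valid_path p" "B-lipschitz_on {0..1} p" "path_image p \<subseteq> path_image c"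
    "pathstart p = a" "pathfinish p = a" "winding_number p 0 = of_int k"
    using exists_loop_winding[OF c w] unfolding a_def by blast
  have sub: "closed_segment x y \<subseteq> S" if "x \<in> S" "y \<in> S" for x y
    using that S(1) by (rule closed_segment_subset)
  have aS: "a \<in> S" using S by (simp add: a_def)
  have seg: "0 \<notin> closed_segment z0 a" "0 \<notin> closed_segment a z1" "0 \<notin> closed_segment z1 z0"
    using sub S aS by blast+
  have p0: "0 \<notin> path_image p" using p c by blast
  define v where "v = linepath z0 a +++ p +++ linepath a z1"
  have v_ends: "v 0 = z0" "v 1 = z1"
    using pathstart_join[of "linepath z0 a"] pathfinish_join[of "linepath z0 a" "p +++ linepath a z1"]
    by (auto simp: v_def pathstart_def pathfinish_def linepath_def joinpaths_def)
  have valid: "valid_path v"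
    unfolding v_def using p by (intro valid_path_join) auto
  obtain C where lip: "C-lipschitz_on {0..1} v"
    unfolding v_def using lipschitz_joinpaths[OF lipschitz_linepath lipschitz_joinpaths[OF p(2) lipschitz_linepath]] p
    by (metis pathstart_linepath pathfinish_linepath pathstart_join)
  have img: "path_image v = closed_segment z0 a \<union> (path_image p \<union> closed_segment a z1)"
    unfolding v_def using p by (simp add: path_image_join)
  have v0: "0 \<notin> path_image v"
    using img seg p0 by blast
  have vD: "path_image v \<subseteq> D"
    using img sub[OF S(5) aS] sub[OF aS S(6)] S(3) p(3) D by blast
  \<comment> \<open>The segment from \<open>z1\<close> back to \<open>z0\<close>, added by
    \<open>Ind\<close>, completes the triangle with the two connecting segments; what remains is the
    index of \<open>p\<close>.\<close>
  have "Ind v = winding_number v 0 + winding_number (linepath z1 z0) 0"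
    unfolding Ind_def v_ends using v0 seg valid
    by (intro winding_number_join) (auto simp: valid_path_imp_path pathfinish_def v_ends)
  also have "winding_number v 0 = winding_number (linepath z0 a) 0 + (winding_number p 0 + winding_number (linepath a z1) 0)"
    unfolding v_def using p seg p0
    by (simp add: winding_number_join path_image_join valid_path_imp_path)
  finally have "Ind v = of_int k"
    using winding_number_triangle_eq_0[OF S(1,5) aS S(6) S(2)] p(6) by (simp add: algebra_simps)
  moreover have "H1 v" using valid lip by (rule valid_lipschitz_H1)
  ultimately have "v \<in> Hhat D k z0 z1"
    using v0 vD v_ends by (auto simp: Hhat_def H1_into_def path_image_def)
  moreover have "Maup \<beta> h v < \<infinity>"
    by (rule Maup_lipschitz_finite[OF assms(1,2) lip]) (use v0 in \<open>auto simp: path_image_def\<close>)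
  ultimately show thesis by (rule that)
qed

section \<open>The boundary loop of \<open>D\<close> and the contradiction with minimality\<close>

theorem theorem2p11:
  fixes L h \<beta> t0 t1 :: real
    and Z Z' :: "real \<Rightarrow> complex"
    and z0 z1 :: complex and k :: int and u :: "real \<Rightarrow> complex"
  assumes L: "L > 0" and h: "h > 0" and \<beta>: "\<beta> > 0"
    and t01: "t0 < t1"
    and ode: "\<forall>t\<in>{t0..t1}. Z t \<noteq> 0 \<and> (Z has_vector_derivative Z' t) (at t)
                 \<and> (Z' has_vector_derivative minus_grad_Vb \<beta> (Z t)) (at t)"
    and energy: "\<forall>t\<in>{t0..t1}. (norm (Z' t))\<^sup>2 / 2 + Vb \<beta> (Z t) = h"
    and hit0: "Im (Z t0) = - L" and hit1: "Im (Z t1) = - L"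
    and inP: "\<forall>t\<in>{t0<..<t1}. Im (Z t) > - L"
    and wind: "Ind (\<lambda>s. Z (t0 + s * (t1 - t0))) = 1"
    and ang0: "vec_angle (Z' t0) 1 < pi / 2"
    and ang1: "vec_angle (-1) (Z' t1) > pi / 2"
    and z0: "z0 \<in> closed_segment (Z t0) (Z t1)"
    and z1: "z1 \<in> closed_segment (Z t0) (Z t1)"
    and k: "k \<noteq> 0"
    and D_def: "D = (let c = (\<lambda>s. Z (t0 + s * (t1 - t0))) +++ linepath (Z t1) (Z t0)
                     in path_image c \<union> inside (path_image c))"
    and umem: "u \<in> Hk D k z0 z1"
    and umin: "\<forall>v\<in>Hk D k z0 z1. Maup \<beta> h u \<le> Maup \<beta> h v"
  shows "\<forall>s\<in>{0..1}. u s \<noteq> 0"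
proof (rule ccontr)
  assume coll: "\<not> (\<forall>s\<in>{0..1}. u s \<noteq> 0)"
  \<comment> \<open>\<open>q\<close> is the orbit arc rescaled to unit time, \<open>c\<close> the
    boundary loop generating \<open>D\<close>, and \<open>S\<close> the segment of the line on which
    the endpoints lie.\<close>
  define q where "q = (\<lambda>s. Z (t0 + s * (t1 - t0)))"
  define c where "c = q +++ linepath (Z t1) (Z t0)"
  define S where "S = closed_segment (Z t0) (Z t1)"
  \<comment> \<open>The segment lies at height \<open>- L\<close>, strictly below the
    origin.\<close>
  have "S \<subseteq> {z. Im z = - L}"
    unfolding S_def using hit0 hit1 convex_hyperplane[of "\<i>" "- L"]
    by (intro closed_segment_subset) (auto simp: inner_complex_def)
  then have S0: "0 \<notin> S" using L by auto
  have time: "t0 + s * (t1 - t0) \<in> {t0..t1}" if "s \<in> {0..1}" for s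
  proof -
    have "0 \<le> s * (t1 - t0)" "s * (t1 - t0) \<le> t1 - t0"
      using that t01 mult_right_mono[of s 1 "t1 - t0"] by auto
    then show ?thesis unfolding atLeastAtMost_iff by linarith
  qed
  have der: "(q has_vector_derivative (t1 - t0) *\<^sub>R Z' (t0 + s * (t1 - t0))) (at s)"
    if "s \<in> {0..1}" for s
  proof -
    have "((\<lambda>s. t0 + s * (t1 - t0)) has_vector_derivative (t1 - t0)) (at s)"
      by (auto intro!: derivative_eq_intros simp flip: has_real_derivative_iff_has_vector_derivative)
    moreover have "(Z has_vector_derivative Z' (t0 + s * (t1 - t0))) (at (t0 + s * (t1 - t0)))"
      using ode time[OF that] by blast
    ultimately show ?thesis
      unfolding q_def using vector_diff_chain_at[of "\<lambda>s. t0 + s * (t1 - t0)"] by (simp add: o_def)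
  qed
  \<comment> \<open>The equation of motion makes \<open>Z'\<close> differentiable, hence continuous,
    so the arc is C1 with bounded speed.\<close>
  have "continuous_on {t0..t1} Z'"
    using ode has_vector_derivative_continuous by (intro continuous_at_imp_continuous_on) blast
  then have "continuous_on {0..1} (\<lambda>s. (t1 - t0) *\<^sub>R Z' (t0 + s * (t1 - t0)))"
    using time
    by (intro continuous_on_scaleR continuous_on_const continuous_on_compose2[of "{t0..t1}" Z' "{0..1}" "\<lambda>s. t0 + s * (t1 - t0)"]
        continuous_on_add continuous_on_mult continuous_on_id) auto
  then obtain B where q: "valid_path q" "B-lipschitz_on {0..1} q"
    using C1_imp_valid_lipschitz[OF der] by blast
  have ends: "q 0 = Z t0" "q 1 = Z t1" "pathstart q = Z t0" "pathfinish q = Z t1"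
    by (simp_all add: q_def pathstart_def pathfinish_def)
  have img: "path_image c = path_image q \<union> S"
    unfolding c_def S_def using ends by (simp add: path_image_join closed_segment_commute)
  have "0 \<notin> path_image q"
    using ode time by (force simp: path_image_def q_def)
  then have c0: "0 \<notin> path_image c" using img S0 by simp
  have cD: "path_image c \<subseteq> D"
    unfolding D_def Let_def c_def q_def by blast
  have start: "pathstart c \<in> S"
    using ends by (simp add: c_def S_def)
  have c: "valid_path c" "(2 * max B (norm (Z t0 - Z t1)))-lipschitz_on {0..1} c" "pathfinish c = pathstart c"
    unfolding c_def using q ends by (auto intro!: valid_path_join lipschitz_joinpaths lipschitz_linepath)
  \<comment> \<open>\<open>Ind\<close> closes \<open>q\<close> with exactly the segment used in
    \<open>c\<close>, so the hypothesis on the orbit is the index of the boundary loop.\<close>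
  have "winding_number c 0 = 1"
    using wind unfolding Ind_def c_def by (simp add: ends flip: q_def)
  moreover have "convex S" "S \<subseteq> D" "z0 \<in> S" "z1 \<in> S"
    using img cD z0 z1 by (auto simp: S_def)
  ultimately obtain v where v: "v \<in> Hhat D k z0 z1" "Maup \<beta> h v < \<infinity>"
    using exists_finite_Maup_competitor[OF \<beta> h c c0 _ _ S0 _ start _ _ cD] by metis
  have "u \<in> Coll D z0 z1"
    using umem coll by (auto simp: Hk_def Hhat_def)
  \<comment> \<open>Starting off the origin, a colliding path is not constant, as the infinite value
    requires.\<close>
  moreover have "z0 \<noteq> 0" using z0 S0 by (auto simp: S_def)
  ultimately have "Maup \<beta> h u = \<infinity>"
    using Maup_collision[OF \<beta> h] by blast
  moreover have "Maup \<beta> h u \<le> Maup \<beta> h v"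
    using umin v(1) by (simp add: Hk_def)
  ultimately show False using v(2) by simp
qed

end
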